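(* Let $R$ be a commutative ring and let $n \geq 0$. For all $x=(p,a,f,b) \in R^{n+1}\oplus (R^{n+1})^\vee = R^{n+1}\oplus R^{n+1}$ (with $(p,a)\in R^n\oplus R=R^{n+1}$ and $(f,b)\in (R^n)^\vee\oplus R^\vee=(R^{n+1})^\vee$) and all $\varphi\in SL_{n+1}(R)$, one has $$\Phi_{1,0}\bigl(\varphi^{-1}(p,a),\,(f,b)\circ\varphi\bigr)=\Lambda_0(\varphi^{-1})\,\Phi_{1,0}(x)\,\Lambda_1(\varphi)$$ as homomorphisms $\Lambda_1(R^{n+1})\to\Lambda_0(R^{n+1})$.
   Context: $R$ is a commutative ring; $R^m$ is identified with $(R^m)^\vee$ via the standard basis and its dual basis. Exterior algebra: for a finitely generated projective $R$-module $Q$, $\Lambda(Q)=\Lambda_0(Q)\oplus\Lambda_1(Q)$ with $\Lambda_0(Q)=\bigoplus_{i\ge0}\Lambda^{2i}(Q)$ and $\Lambda_1(Q)=\bigoplus_{i\ge0}\Lambda^{2i+1}(Q)$. An endomorphism $\varphi$ of $Q$ induces an algebra endomorphism $\Lambda(\varphi)$ of $\Lambda(Q)$, which preserves $\Lambda_0(Q)$ and $\Lambda_1(Q)$; $\Lambda_i(\varphi):\Lambda_i(Q)\to\Lambda_i(Q)$ denotes its restriction, $i=0,1$. The map $\Phi$: let $P=R^n$ and $x=(p,a,f,b)\in P\oplus R\oplus P^\vee\oplus R^\vee$. Put $x'=(p,a)\in P\oplus R$ and $x''=(f,b)\in (P\oplus R)^\vee$. Let $l_{x'}:\Lambda(P\oplus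 R)\to\Lambda(P\oplus R)$ be left multiplication $\omega\mapsto x'\wedge\omega$, and let $d_{x''}$ be given by $d_{x''}(y_1\wedge\dots\wedge y_r)=\sum_{i=1}^r(-1)^{i+1}x''(y_i)\,y_1\wedge\dots\wedge\widehat{y_i}\wedge\dots\wedge y_r$. Set $\Phi(x)=\Phi(x',x'')=l_{x'}+d_{x''}$. It interchanges $\Lambda_0$ and $\Lambda_1$; $\Phi_{1,0}(x)=\Phi_{1,0}(x',x''):\Lambda_1(P\oplus R)\to\Lambda_0(P\oplus R)$ denotes its restriction to $\Lambda_1(P\oplus R)$. Here $P\oplus R=R^{n+1}$, $\varphi\in SL_{n+1}(R)$ is viewed as an automorphism of $R^{n+1}$, and $(f,b)\circ\varphi$ is the composition of the linear form $(f,b):R^{n+1}\to R$ with $\varphi$. *)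

theory Defs
  imports "HOL-Analysis.Analysis" "HOL-Library.Poly_Mapping"
begin

section \<open>The exterior algebra of a free module of finite rank\<close>

text \<open>
  The free module of rank \<open>n + 1\<close> over the commutative ring \<open>'r\<close> is \<open>'r ^ 'n\<close>, where \<open>'n\<close> is a finite
  index type with \<open>CARD('n) = n + 1\<close>; index types are nonempty, so every rank that is at least 1
  occurs. The exterior algebra is the free associative unital algebra on the underlying set of the
  module, modulo the two-sided ideal that makes \<open>v \<mapsto> [v]\<close> linear and gives \<open>v \<and> v = 0\<close>. This
  is the tensor algebra modulo the squares \<open>v \<otimes> v\<close>, and involves no choice of basis.
\<close>

datatype 'a word = Word (letters: "'a list")

instantiation word :: (type) monoid_add
begin
definition zero_word :: "'a word" where "zero_word = Word []"
definition plus_word :: "'a word \<Rightarrow> 'a word \<Rightarrow> 'a word"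
  where "plus_word u v = Word (letters u @ letters v)"
instance by standard (simp_all add: zero_word_def plus_word_def)
end

type_synonym ('r, 'n) free_alg = "('r ^ 'n) word \<Rightarrow>\<^sub>0 'r"

definition fconst :: "'r \<Rightarrow> ('r::comm_ring_1, 'n::finite) free_alg"
  where "fconst c = Poly_Mapping.single (Word []) c"

definition fword :: "('r ^ 'n) list \<Rightarrow> ('r::comm_ring_1, 'n::finite) free_alg"
  where "fword ys = Poly_Mapping.single (Word ys) 1"

inductive_set ext_ideal :: "('r::comm_ring_1, 'n::finite) free_alg set" where
  zero: "0 \<in> ext_ideal"
| add: "a \<in> ext_ideal \<Longrightarrow> b \<in> ext_ideal \<Longrightarrow> a + b \<in> ext_ideal"
| mult: "a \<in> ext_ideal \<Longrightarrow> s * a * t \<in> ext_ideal"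
| gen_add: "fword [u + v] - fword [u] - fword [v] \<in> ext_ideal"
| gen_scale: "fword [c *s v] - fconst c * fword [v] \<in> ext_ideal"
| gen_square: "fword [v, v] \<in> ext_ideal"

lemma ext_ideal_minus: "a \<in> ext_ideal \<Longrightarrow> - a \<in> ext_ideal"
  using ext_ideal.mult[of a "-1" 1] by simp

lemma ext_ideal_diff: "a \<in> ext_ideal \<Longrightarrow> b \<in> ext_ideal \<Longrightarrow> a - b \<in> ext_ideal"
  using ext_ideal.add[OF _ ext_ideal_minus] by fastforce

lemma ext_ideal_mult_left: "a \<in> ext_ideal \<Longrightarrow> s * a \<in> ext_ideal"
  using ext_ideal.mult[of a s 1] by simp

lemma ext_ideal_mult_right: "a \<in> ext_ideal \<Longrightarrow> a * t \<in> ext_ideal"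
  using ext_ideal.mult[of a 1 t] by simp

lemma fconst_0 [simp]: "fconst 0 = 0"
  by (simp add: fconst_def)

lemma fconst_1 [simp]: "fconst 1 = 1"
  using single_one by (simp add: fconst_def zero_word_def[symmetric])

lemma fconst_add: "fconst (a + b) = fconst a + fconst b"
  by (simp add: fconst_def single_add)

lemma fconst_minus: "fconst (- a) = - fconst a"
  by (simp add: fconst_def single_uminus)

lemma fconst_mult: "fconst (a * b) = fconst a * fconst b"
  by (simp add: fconst_def mult_single plus_word_def)

lemma fword_Nil [simp]: "fword [] = 1"
  using single_one by (simp add: fword_def zero_word_def[symmetric])

lemma fword_append: "fword (u @ v) = fword u * fword v"
  by (simp add: fword_def mult_single plus_word_def)

lemma fconst_fword: "fconst c * fword ys = Poly_Mapping.single (Word ys) c"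
  by (simp add: fconst_def fword_def mult_single plus_word_def)

lemma free_alg_sum:
  fixes t :: "('r::comm_ring_1, 'n::finite) free_alg"
  shows "t = (\<Sum>w\<in>Poly_Mapping.keys t. fconst (Poly_Mapping.lookup t w) * fword (letters w))"
  by (rule poly_mapping_eqI)
    (auto simp: fconst_fword lookup_sum lookup_single when_def in_keys_iff)

lemma free_alg_induct [case_names zero add word]:
  fixes t :: "('r::comm_ring_1, 'n::finite) free_alg"
  assumes "P 0" and add: "\<And>s t. P s \<Longrightarrow> P t \<Longrightarrow> P (s + t)" and "\<And>c ys. P (fconst c * fword ys)"
  shows "P t"
proof -
  have "P (\<Sum>w\<in>A. fconst (Poly_Mapping.lookup t w) * fword (letters w))" if "finite A" for A
    using that by (induction A) (auto intro: assms)
  from this[OF finite_keys, of t] show ?thesis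
    unfolding free_alg_sum[of t, symmetric] .
qed

lemma fconst_central: "fconst c * t = t * fconst c"
proof (induction t rule: free_alg_induct)
  case (word d ys)
  show ?case
    by (simp add: fconst_fword) (simp add: fconst_def mult_single plus_word_def mult.commute)
qed (simp_all add: algebra_simps)

quotient_type (overloaded) ('r, 'n) ext = "('r::comm_ring_1, 'n::finite) free_alg" /
    "\<lambda>a b. a - b \<in> ext_ideal"
proof (rule equivpI)
  show "reflp (\<lambda>a b :: ('r, 'n) free_alg. a - b \<in> ext_ideal)"
    by (rule reflpI) (simp add: ext_ideal.zero)
  show "symp (\<lambda>a b :: ('r, 'n) free_alg. a - b \<in> ext_ideal)"
    by (rule sympI) (use ext_ideal_minus in fastforce)
  show "transp (\<lambda>a b :: ('r, 'n) free_alg. a - b \<in> ext_ideal)"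
    by (rule transpI) (use ext_ideal.add in fastforce)
qed

lemma one_notin_ext_ideal: "(1 :: ('r::comm_ring_1, 'n::finite) free_alg) \<notin> ext_ideal"
proof -
  let ?e = "\<lambda>t :: ('r, 'n) free_alg. Poly_Mapping.lookup t 0"
  have w: "?e (fword ys) = (if ys = [] then 1 else 0)" for ys
    by (simp add: fword_def lookup_single when_def zero_word_def)
  have c: "?e (fconst c) = c" for c
    by (simp add: fconst_def lookup_single when_def zero_word_def)
  have cw: "?e (fconst c * fword ys) = (if ys = [] then c else 0)" for c ys
    by (simp add: fconst_fword lookup_single when_def zero_word_def)
  have "?e (fconst c * fword ys * (fconst d * fword zs))
      = ?e (fconst c * fword ys) * ?e (fconst d * fword zs)" for c d ys zs
    by (simp add: fconst_fword mult_single plus_word_def lookup_single when_def zero_word_def)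
  then have "?e (fconst c * fword ys * t) = ?e (fconst c * fword ys) * ?e t" for c ys t
    by (induction t rule: free_alg_induct) (simp_all add: distrib_left lookup_add)
  then have m: "?e (s * t) = ?e s * ?e t" for s t
    by (induction s rule: free_alg_induct) (simp_all add: distrib_right lookup_add)
  have "?e t = 0" if "t \<in> ext_ideal" for t
    using that by induction (simp_all add: lookup_add lookup_minus m w)
  then show ?thesis
    by (metis fword_Nil w zero_neq_one)
qed

instantiation ext :: (comm_ring_1, finite) ring_1
begin
lift_definition zero_ext :: "('a, 'b) ext" is 0 .
lift_definition one_ext :: "('a, 'b) ext" is 1 .
lift_definition plus_ext :: "('a, 'b) ext \<Rightarrow> ('a, 'b) ext \<Rightarrow> ('a, 'b) ext" is "(+)"
  by (metis add_diff_add ext_ideal.add)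
lift_definition uminus_ext :: "('a, 'b) ext \<Rightarrow> ('a, 'b) ext" is uminus
  by (metis ext_ideal_minus minus_diff_minus)
lift_definition minus_ext :: "('a, 'b) ext \<Rightarrow> ('a, 'b) ext \<Rightarrow> ('a, 'b) ext" is "(-)"
proof -
  fix a b c d :: "('a, 'b) free_alg"
  assume "a - b \<in> ext_ideal" "c - d \<in> ext_ideal"
  then show "a - c - (b - d) \<in> ext_ideal"
    using ext_ideal_diff[of "a - b" "c - d"] by (simp add: algebra_simps)
qed
lift_definition times_ext :: "('a, 'b) ext \<Rightarrow> ('a, 'b) ext \<Rightarrow> ('a, 'b) ext" is "(*)"
proof -
  fix a b c d :: "('a, 'b) free_alg"
  assume "a - b \<in> ext_ideal" "c - d \<in> ext_ideal"
  then have "(a - b) * c + b * (c - d) \<in> ext_ideal"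
    by (intro ext_ideal.add ext_ideal_mult_left ext_ideal_mult_right)
  then show "a * c - b * d \<in> ext_ideal"
    by (simp add: algebra_simps)
qed
instance
proof
  show "(0 :: ('a, 'b) ext) \<noteq> 1"
    by transfer (use one_notin_ext_ideal ext_ideal_minus in fastforce)
qed (transfer, simp add: algebra_simps ext_ideal.zero)+
end

lift_definition ext_scale :: "'r \<Rightarrow> ('r::comm_ring_1, 'n::finite) ext \<Rightarrow> ('r, 'n) ext"
  is "\<lambda>c t. fconst c * t"
  by (metis ext_ideal_mult_left right_diff_distrib)

lift_definition ext_vec :: "'r ^ 'n \<Rightarrow> ('r::comm_ring_1, 'n::finite) ext" is "\<lambda>v. fword [v]" .

definition wedge :: "('r ^ 'n) list \<Rightarrow> ('r::comm_ring_1, 'n::finite) ext"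
  where "wedge ys = prod_list (map ext_vec ys)"

global_interpretation ext: module ext_scale
  by unfold_locales
    (transfer, simp add: algebra_simps fconst_add fconst_mult ext_ideal.zero)+

lemma ext_scale_mult_left: "ext_scale c a * b = ext_scale c (a * b)"
  by transfer (simp add: mult.assoc ext_ideal.zero)

lemma ext_scale_mult_right: "a * ext_scale c b = ext_scale c (a * b)"
  by transfer (metis (no_types, lifting) fconst_central mult.assoc diff_self ext_ideal.zero)

lemma ext_vec_add: "ext_vec (u + v) = ext_vec u + ext_vec v"
  by transfer (metis (no_types, lifting) diff_diff_add ext_ideal.gen_add)

lemma ext_vec_scale: "ext_vec (c *s v) = ext_scale c (ext_vec v)"
  by transfer (rule ext_ideal.gen_scale)

lemma ext_vec_square: "ext_vec v * ext_vec v = 0"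
  by transfer (use ext_ideal.gen_square in \<open>simp add: fword_append[symmetric]\<close>)

lemma abs_ext_fword: "abs_ext (fword ys) = wedge ys"
proof (induction ys)
  case Nil
  then show ?case by (simp add: wedge_def one_ext_def)
next
  case (Cons y ys)
  have "abs_ext (fword (y # ys)) = abs_ext (fword [y]) * abs_ext (fword ys)"
    using fword_append[of "[y]" ys] by (simp add: times_ext.abs_eq)
  then show ?case
    using Cons by (simp add: wedge_def ext_vec.abs_eq)
qed

lemma ext_induct [case_names zero add scale wedge]:
  assumes "P 0" "\<And>s t. P s \<Longrightarrow> P t \<Longrightarrow> P (s + t)" "\<And>c t. P t \<Longrightarrow> P (ext_scale c t)"
    and "\<And>ys. P (wedge ys)"
  shows "P \<omega>"
proof -
  have "P (abs_ext t)" for t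
  proof (induction t rule: free_alg_induct)
    case zero
    show ?case
      using assms(1) by (simp only: zero_ext_def)
  next
    case (add s t)
    show ?case
      using assms(2)[OF add] by (simp only: plus_ext.abs_eq)
  next
    case (word c ys)
    show ?case
      using assms(3)[OF assms(4)] by (simp only: abs_ext_fword[symmetric] ext_scale.abs_eq)
  qed
  then show ?thesis
    by (rule ext.abs_induct)
qed


section \<open>Grading, induced endomorphisms, contraction\<close>

definition ext_power :: "nat \<Rightarrow> ('r::comm_ring_1, 'n::finite) ext set"
  where "ext_power k = ext.span {wedge ys | ys. length ys = k}"

definition ext_even :: "('r::comm_ring_1, 'n::finite) ext set"
  where "ext_even = ext.span (\<Union>i. ext_power (2 * i))"

definition ext_odd :: "('r::comm_ring_1, 'n::finite) ext set"
  where "ext_odd = ext.span (\<Union>i. ext_power (2 * i + 1))"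

definition word_extend ::
    "(('r ^ 'n) list \<Rightarrow> ('r, 'n) free_alg) \<Rightarrow> ('r::comm_ring_1, 'n::finite) free_alg \<Rightarrow> ('r, 'n) free_alg"
  where "word_extend F t =
    (\<Sum>w\<in>Poly_Mapping.keys t. fconst (Poly_Mapping.lookup t w) * F (letters w))"

text \<open>
  The next two maps are evaluated on a representative in the free algebra. They are independent of
  the representative if \<open>\<phi>\<close> and \<open>\<xi>\<close> are linear, which yields the characterisations
  \<open>ext_map_wedge\<close>, \<open>ext_map_mult\<close> and \<open>ext_contract_wedge\<close> below.
\<close>

definition ext_map :: "('r ^ 'n \<Rightarrow> 'r ^ 'n) \<Rightarrow> ('r::comm_ring_1, 'n::finite) ext \<Rightarrow> ('r, 'n) ext"
  where "ext_map \<phi> \<omega> = abs_ext (word_extend (\<lambda>ys. fword (map \<phi> ys)) (rep_ext \<omega>))"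

text \<open>List positions start at 0, so that the sign \<open>(-1)^(i+1)\<close> of the \<open>i\<close>-th factor becomes \<open>(-1)^i\<close>.\<close>

definition word_contract :: "('r ^ 'n \<Rightarrow> 'r) \<Rightarrow> ('r ^ 'n) list \<Rightarrow> ('r::comm_ring_1, 'n::finite) free_alg"
  where "word_contract \<xi> ys =
    (\<Sum>i<length ys. fconst ((-1) ^ i * \<xi> (ys ! i)) * fword (take i ys @ drop (Suc i) ys))"

definition ext_contract :: "('r ^ 'n \<Rightarrow> 'r) \<Rightarrow> ('r::comm_ring_1, 'n::finite) ext \<Rightarrow> ('r, 'n) ext"
  where "ext_contract \<xi> \<omega> = abs_ext (word_extend (word_contract \<xi>) (rep_ext \<omega>))"

lemma word_extend_superset:
  assumes "finite S" "Poly_Mapping.keys t \<subseteq> S"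
  shows "word_extend F t = (\<Sum>w\<in>S. fconst (Poly_Mapping.lookup t w) * F (letters w))"
  unfolding word_extend_def using assms
  by (intro sum.mono_neutral_left) (auto simp: in_keys_iff)

lemma word_extend_0 [simp]: "word_extend F 0 = 0"
  by (simp add: word_extend_def)

lemma word_extend_add: "word_extend F (s + t) = word_extend F s + word_extend F t"
proof -
  let ?S = "Poly_Mapping.keys s \<union> Poly_Mapping.keys t"
  have "Poly_Mapping.keys (s + t) \<subseteq> ?S"
    by (rule keys_add)
  then show ?thesis
    using word_extend_superset[of ?S s F] word_extend_superset[of ?S t F]
      word_extend_superset[of ?S "s + t" F]
    by (simp add: lookup_add fconst_add distrib_right sum.distrib)
qed

lemma word_extend_single: "word_extend F (fconst c * fword ys) = fconst c * F ys"
  using word_extend_superset[of "{Word ys}" "fconst c * fword ys" F]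
  by (simp add: fconst_fword)

lemma word_extend_fword [simp]: "word_extend F (fword ys) = F ys"
  using word_extend_single[of F 1 ys] by simp

lemma word_extend_scale: "word_extend F (fconst c * t) = fconst c * word_extend F t"
proof (induction t rule: free_alg_induct)
  case (word d ys)
  show ?case
    using word_extend_single[of F "c * d" ys] word_extend_single[of F d ys]
    by (simp add: fconst_mult mult.assoc)
qed (simp_all add: word_extend_add distrib_left)

lemma word_extend_minus: "word_extend F (- t) = - word_extend F t"
  using word_extend_scale[of F "-1" t] by (simp add: fconst_minus)

lemma word_extend_diff: "word_extend F (s - t) = word_extend F s - word_extend F t"
  using word_extend_add[of F s "- t"] by (simp add: word_extend_minus)

lemma word_extend_map_mult:
  "word_extend (\<lambda>ys. fword (map \<phi> ys)) (s * t)
    = word_extend (\<lambda>ys. fword (map \<phi> ys)) s * word_extend (\<lambda>ys. fword (map \<phi> ys)) t"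
  (is "?F (s * t) = _")
proof -
  have *: "?F (fconst c * fword ys * t) = fconst c * fword (map \<phi> ys) * ?F t" for c ys t
  proof (induction t rule: free_alg_induct)
    case (word d zs)
    have "fconst c * fword ys * (fconst d * fword zs) = fconst c * (fconst d * fword (ys @ zs))"
      by (metis (no_types, lifting) fconst_central fword_append mult.assoc)
    then have "?F (fconst c * fword ys * (fconst d * fword zs))
        = fconst c * (fconst d * fword (map \<phi> ys @ map \<phi> zs))"
      by (simp add: word_extend_scale)
    also have "\<dots> = fconst c * fword (map \<phi> ys) * (fconst d * fword (map \<phi> zs))"
      by (metis (no_types, lifting) fconst_central fword_append mult.assoc)
    finally show ?case
      by (simp add: word_extend_scale)
  qed (simp_all add: word_extend_add distrib_left)
  show ?thesis
    by (induction s rule: free_alg_induct)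
      (simp_all add: * word_extend_add distrib_right word_extend_scale)
qed

lemma word_extend_map_ideal:
  assumes \<phi>: "module_hom (*s) (*s) \<phi>" and t: "t \<in> ext_ideal"
  shows "word_extend (\<lambda>ys. fword (map \<phi> ys)) t \<in> ext_ideal"
proof -
  interpret module_hom "(*s)" "(*s)" \<phi> by fact
  show ?thesis
    using t by induction
      (auto simp: word_extend_add word_extend_diff word_extend_scale add scale intro: ext_ideal.intros,
        simp add: word_extend_map_mult ext_ideal.mult)
qed

lemma word_contract_append:
  "word_contract \<xi> (u @ v)
    = word_contract \<xi> u * fword v + fconst ((-1) ^ length u) * fword u * word_contract \<xi> v"
proof (induction v rule: rev_induct)
  case Nil
  then show ?case by (simp add: word_contract_def)
next
  case (snoc y v)
  have s: "word_contract \<xi> (w @ [y])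
      = word_contract \<xi> w * fword [y] + fconst ((-1) ^ length w * \<xi> y) * fword w" for w
  proof -
    have "word_contract \<xi> (w @ [y]) =
      (\<Sum>i<length w. fconst ((-1) ^ i * \<xi> (w ! i)) * fword (take i w @ drop (Suc i) w @ [y]))
      + fconst ((-1) ^ length w * \<xi> y) * fword w"
      by (simp add: word_contract_def nth_append)
    also have "(\<Sum>i<length w. fconst ((-1) ^ i * \<xi> (w ! i)) * fword (take i w @ drop (Suc i) w @ [y]))
        = word_contract \<xi> w * fword [y]"
      by (simp add: word_contract_def sum_distrib_right fword_append mult.assoc)
    finally show ?thesis .
  qed
  have c: "fconst ((-1) ^ length u) * fword u * (fconst ((-1) ^ length v * \<xi> y) * fword v)
      = fconst ((-1) ^ length (u @ v) * \<xi> y) * fword (u @ v)"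
    by (metis (no_types, lifting) fconst_central fword_append mult.assoc fconst_mult power_add length_append)
  show ?case
    using s[of "u @ v"] s[of v] snoc c
    by (simp add: fword_append distrib_left distrib_right mult.assoc)
qed

definition free_sign :: "('r::comm_ring_1, 'n::finite) free_alg \<Rightarrow> ('r, 'n) free_alg"
  where "free_sign = word_extend (\<lambda>ys. fconst ((-1) ^ length ys) * fword ys)"

lemma free_sign_mult: "free_sign (s * t) = free_sign s * free_sign t"
proof -
  have *: "free_sign (fconst c * fword ys * t)
      = fconst c * (fconst ((-1) ^ length ys) * fword ys) * free_sign t" for c ys t
  proof (induction t rule: free_alg_induct)
    case (word d zs)
    have "fconst c * fword ys * (fconst d * fword zs) = fconst c * (fconst d * fword (ys @ zs))"
      by (metis (no_types, lifting) fconst_central fword_append mult.assoc)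
    then have "free_sign (fconst c * fword ys * (fconst d * fword zs))
        = fconst c * (fconst d * (fconst ((-1) ^ length (ys @ zs)) * fword (ys @ zs)))"
      by (simp add: free_sign_def word_extend_scale)
    also have "\<dots> = fconst c * (fconst ((-1) ^ length ys) * fword ys)
        * (fconst d * (fconst ((-1) ^ length zs) * fword zs))"
      by (metis (no_types, lifting) fconst_central fword_append mult.assoc fconst_mult power_add
          length_append)
    finally show ?case
      by (simp add: free_sign_def word_extend_scale)
  qed (simp_all add: free_sign_def word_extend_add distrib_left)
  show ?thesis
    by (induction s rule: free_alg_induct)
      (simp_all add: *, simp_all add: free_sign_def word_extend_add distrib_right word_extend_scale)
qed

lemma free_sign_ideal: "t \<in> ext_ideal \<Longrightarrow> free_sign t \<in> ext_ideal"
proof (induction rule: ext_ideal.induct)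
  case (mult a s t)
  then show ?case by (simp add: free_sign_mult ext_ideal.mult)
next
  case (gen_add u v)
  have "free_sign (fword [u + v] - fword [u] - fword [v])
      = fconst (-1) * (fword [u + v] - fword [u] - fword [v])"
    by (simp add: free_sign_def word_extend_diff right_diff_distrib)
  then show ?case by (simp add: ext_ideal.gen_add ext_ideal_mult_left)
next
  case (gen_scale c v)
  have "free_sign (fword [c *s v] - fconst c * fword [v])
      = fconst (-1) * (fword [c *s v] - fconst c * fword [v])"
    by (simp add: free_sign_def word_extend_diff word_extend_scale right_diff_distrib fconst_minus)
  then show ?case by (simp add: ext_ideal.gen_scale ext_ideal_mult_left)
qed (simp_all add: free_sign_def word_extend_add ext_ideal.intros)

lemma word_extend_contract_mult:
  "word_extend (word_contract \<xi>) (s * t)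
    = word_extend (word_contract \<xi>) s * t + free_sign s * word_extend (word_contract \<xi>) t"
  (is "?D (s * t) = _")
proof -
  have *: "?D (fconst c * fword ys * t) = fconst c * word_contract \<xi> ys * t
      + fconst c * (fconst ((-1) ^ length ys) * fword ys) * ?D t" for c ys t
  proof (induction t rule: free_alg_induct)
    case (word d zs)
    have "fconst c * fword ys * (fconst d * fword zs) = fconst c * (fconst d * fword (ys @ zs))"
      by (metis (no_types, lifting) fconst_central fword_append mult.assoc)
    then have "?D (fconst c * fword ys * (fconst d * fword zs))
        = fconst c * (fconst d * (word_contract \<xi> ys * fword zs))
          + fconst c * (fconst d * (fconst ((-1) ^ length ys) * fword ys * word_contract \<xi> zs))"
      by (simp add: word_extend_scale word_contract_append distrib_left)
    also have "fconst c * (fconst d * (word_contract \<xi> ys * fword zs))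
        = fconst c * word_contract \<xi> ys * (fconst d * fword zs)"
      by (metis (no_types, lifting) fconst_central mult.assoc)
    also have "fconst c * (fconst d * (fconst ((-1) ^ length ys) * fword ys * word_contract \<xi> zs))
        = fconst c * (fconst ((-1) ^ length ys) * fword ys) * (fconst d * word_contract \<xi> zs)"
      by (metis (no_types, lifting) fconst_central mult.assoc)
    finally show ?case
      by (simp add: word_extend_scale)
  qed (simp_all add: word_extend_add algebra_simps)
  show ?thesis
    by (induction s rule: free_alg_induct)
      (simp_all add: *, simp_all add: free_sign_def word_extend_add algebra_simps word_extend_scale)
qed

lemma word_extend_contract_ideal:
  assumes \<xi>: "module_hom (*s) (*) \<xi>" and t: "t \<in> ext_ideal"
  shows "word_extend (word_contract \<xi>) t \<in> ext_ideal"
proof -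
  interpret module_hom "(*s)" "(*)" \<xi> by fact
  have c1: "word_contract \<xi> [v] = fconst (\<xi> v)" for v
    by (simp add: word_contract_def)
  have c2: "word_contract \<xi> [v, v] = 0" for v
    by (simp add: word_contract_def fconst_minus lessThan_Suc)
  show ?thesis
    using t
  proof induction
    case (mult a s t)
    then show ?case
      by (simp add: word_extend_contract_mult free_sign_mult)
        (intro ext_ideal.add ext_ideal_mult_left ext_ideal_mult_right free_sign_ideal ext_ideal.mult)
  qed (simp_all add: word_extend_add word_extend_diff word_extend_scale c1 c2 add scale
      fconst_add fconst_mult ext_ideal.zero ext_ideal.add)
qed

context
  fixes \<phi> :: "'r::comm_ring_1 ^ 'n::finite \<Rightarrow> 'r ^ 'n"
  assumes \<phi>: "module_hom (*s) (*s) \<phi>"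
begin

lemma ext_map_abs: "ext_map \<phi> (abs_ext t) = abs_ext (word_extend (\<lambda>ys. fword (map \<phi> ys)) t)"
proof -
  have "rep_ext (abs_ext t) - t \<in> ext_ideal"
    by (simp add: Quotient3_ext rep_abs_rsp_left ext.abs_eq_iff[symmetric]
        Quotient3_abs_rep[OF Quotient3_ext])
  then show ?thesis
    using word_extend_map_ideal[OF \<phi>] by (simp add: ext_map_def ext.abs_eq_iff word_extend_diff[symmetric])
qed

lemma ext_map_wedge: "ext_map \<phi> (wedge ys) = wedge (map \<phi> ys)"
  using ext_map_abs[of "fword ys"] by (simp add: abs_ext_fword)

lemma ext_map_one: "ext_map \<phi> 1 = 1"
  using ext_map_wedge[of "[]"] by (simp add: wedge_def)

lemma ext_map_add: "ext_map \<phi> (s + t) = ext_map \<phi> s + ext_map \<phi> t"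
  by (induct s rule: ext.abs_induct, induct t rule: ext.abs_induct)
    (simp add: plus_ext.abs_eq ext_map_abs word_extend_add)

lemma ext_map_mult: "ext_map \<phi> (s * t) = ext_map \<phi> s * ext_map \<phi> t"
  by (induct s rule: ext.abs_induct, induct t rule: ext.abs_induct)
    (simp add: times_ext.abs_eq ext_map_abs word_extend_map_mult)

lemma ext_map_scale: "ext_map \<phi> (ext_scale c t) = ext_scale c (ext_map \<phi> t)"
  by (induct t rule: ext.abs_induct) (simp add: ext_scale.abs_eq ext_map_abs word_extend_scale)

end

context
  fixes \<xi> :: "'r::comm_ring_1 ^ 'n::finite \<Rightarrow> 'r"
  assumes \<xi>: "module_hom (*s) (*) \<xi>"
begin

lemma ext_contract_abs: "ext_contract \<xi> (abs_ext t) = abs_ext (word_extend (word_contract \<xi>) t)"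
proof -
  have "rep_ext (abs_ext t) - t \<in> ext_ideal"
    by (simp add: Quotient3_ext rep_abs_rsp_left ext.abs_eq_iff[symmetric]
        Quotient3_abs_rep[OF Quotient3_ext])
  then show ?thesis
    using word_extend_contract_ideal[OF \<xi>]
    by (simp add: ext_contract_def ext.abs_eq_iff word_extend_diff[symmetric])
qed

lemma ext_contract_add: "ext_contract \<xi> (s + t) = ext_contract \<xi> s + ext_contract \<xi> t"
  by (induct s rule: ext.abs_induct, induct t rule: ext.abs_induct)
    (simp add: plus_ext.abs_eq ext_contract_abs word_extend_add)

lemma ext_contract_scale: "ext_contract \<xi> (ext_scale c t) = ext_scale c (ext_contract \<xi> t)"
  by (induct t rule: ext.abs_induct) (simp add: ext_scale.abs_eq ext_contract_abs word_extend_scale)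

lemma ext_contract_wedge:
  "ext_contract \<xi> (wedge ys)
    = (\<Sum>i<length ys. ext_scale ((-1) ^ i * \<xi> (ys ! i)) (wedge (take i ys @ drop (Suc i) ys)))"
proof -
  have s: "abs_ext (sum f A) = (\<Sum>i\<in>A. abs_ext (f i))" for f :: "nat \<Rightarrow> ('r, 'n) free_alg" and A
    by (induction A rule: infinite_finite_induct)
      (simp_all add: zero_ext_def plus_ext.abs_eq[symmetric])
  show ?thesis
    using ext_contract_abs[of "fword ys"]
    by (simp add: abs_ext_fword word_contract_def s ext_scale.abs_eq[symmetric])
qed

end


section \<open>The map \<open>\<Phi>\<close>\<close>

text \<open>
  \<open>scalar_product f\<close> is the linear form with coordinates \<open>f\<close> in the dual of the standard basis.
  The second argument of \<open>Phi\<close> is the linear form itself, so that it can be composed with \<open>\<phi>\<close>.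
  An argument \<open>x = (p, a, f, b)\<close> is given by the two vectors \<open>pa = (p, a)\<close> and \<open>fb = (f, b)\<close> of
  \<open>'r ^ 'n\<close>; \<open>Phi10\<close>, \<open>ext_map0\<close> and \<open>ext_map1\<close> are restrictions to submodules, taken to be
  \<open>undefined\<close> elsewhere, and are composed with \<open>compose\<close>.
\<close>

definition Phi :: "'r ^ 'n \<Rightarrow> ('r ^ 'n \<Rightarrow> 'r) \<Rightarrow> ('r::comm_ring_1, 'n::finite) ext \<Rightarrow> ('r, 'n) ext"
  where "Phi x' \<xi> \<omega> = ext_vec x' * \<omega> + ext_contract \<xi> \<omega>"

definition Phi10 :: "'r ^ 'n \<Rightarrow> ('r ^ 'n \<Rightarrow> 'r) \<Rightarrow> ('r::comm_ring_1, 'n::finite) ext \<Rightarrow> ('r, 'n) ext"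
  where "Phi10 x' \<xi> = restrict (Phi x' \<xi>) ext_odd"

definition ext_map0 :: "('r ^ 'n \<Rightarrow> 'r ^ 'n) \<Rightarrow> ('r::comm_ring_1, 'n::finite) ext \<Rightarrow> ('r, 'n) ext"
  where "ext_map0 \<phi> = restrict (ext_map \<phi>) ext_even"

definition ext_map1 :: "('r ^ 'n \<Rightarrow> 'r ^ 'n) \<Rightarrow> ('r::comm_ring_1, 'n::finite) ext \<Rightarrow> ('r, 'n) ext"
  where "ext_map1 \<phi> = restrict (ext_map \<phi>) ext_odd"

lemma wedge_in_even: "even (length ys) \<Longrightarrow> wedge ys \<in> ext_even"
  unfolding ext_even_def ext_power_def
  by (elim evenE) (intro ext.span_base UN_I[of "length ys div 2"], auto intro: ext.span_base)

lemma wedge_in_odd: "odd (length ys) \<Longrightarrow> wedge ys \<in> ext_odd"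
  unfolding ext_odd_def ext_power_def
  by (elim oddE) (intro ext.span_base UN_I[of "length ys div 2"], auto intro: ext.span_base)

lemma ext_even_eq_span: "ext_even = ext.span {wedge ys | ys. even (length ys)}"
proof
  show "ext_even \<subseteq> ext.span {wedge ys | ys. even (length ys)}"
    unfolding ext_even_def ext_power_def
    by (intro ext.span_minimal UN_least ext.subspace_span) (auto intro!: ext.span_base)
  show "ext.span {wedge ys | ys. even (length ys)} \<subseteq> ext_even"
    by (rule ext.span_minimal) (use wedge_in_even in blast, simp add: ext_even_def)
qed

lemma ext_odd_eq_span: "ext_odd = ext.span {wedge ys | ys. odd (length ys)}"
proof
  show "ext_odd \<subseteq> ext.span {wedge ys | ys. odd (length ys)}"
    unfolding ext_odd_def ext_power_def
    by (intro ext.span_minimal UN_least ext.subspace_span) (auto intro!: ext.span_base)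
  show "ext.span {wedge ys | ys. odd (length ys)} \<subseteq> ext_odd"
    by (rule ext.span_minimal) (use wedge_in_odd in blast, simp add: ext_odd_def)
qed

lemma ext_span_image:
  assumes "\<And>s t. f (s + t) = f s + f t" "\<And>c t. f (ext_scale c t) = ext_scale c (f t)"
    and "\<And>t. t \<in> A \<Longrightarrow> f t \<in> ext.span B" and "t \<in> ext.span A"
  shows "f t \<in> ext.span B"
proof -
  have "module_hom ext_scale ext_scale f"
    by (intro module_hom.intro module_hom_axioms.intro ext.module_axioms assms(1,2))
  then have "f ` ext.span A = ext.span (f ` A)"
    by (simp add: module_hom.span_image)
  moreover have "ext.span (f ` A) \<subseteq> ext.span B"
    by (intro ext.span_minimal) (use assms(3) in auto)
  ultimately show ?thesis
    using assms(4) by blast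
qed

lemma ext_map0_in:
  fixes \<phi> :: "'r::comm_ring_1 ^ 'n::finite \<Rightarrow> 'r ^ 'n"
  assumes "module_hom (*s) (*s) \<phi>"
  shows "ext_map0 \<phi> \<in> ext_even \<rightarrow> ext_even"
proof (rule funcsetI)
  fix \<omega> :: "('r, 'n) ext"
  assume \<omega>: "\<omega> \<in> ext_even"
  have "ext_map \<phi> \<omega> \<in> ext.span {wedge ys | ys. even (length ys)}"
  proof (rule ext_span_image[where f = "ext_map \<phi>" and A = "{wedge ys | ys. even (length ys)}"])
    show "ext_map \<phi> t \<in> ext.span {wedge ys | ys. even (length ys)}"
      if "t \<in> {wedge ys | ys. even (length ys)}" for t
      using that by (auto simp: ext_map_wedge[OF assms] intro!: ext.span_base)
  qed (use \<omega> in \<open>simp_all add: ext_even_eq_span ext_map_add[OF assms] ext_map_scale[OF assms]\<close>)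
  then show "ext_map0 \<phi> \<omega> \<in> ext_even"
    using \<omega> by (simp add: ext_map0_def ext_even_eq_span)
qed

lemma ext_map1_in:
  fixes \<phi> :: "'r::comm_ring_1 ^ 'n::finite \<Rightarrow> 'r ^ 'n"
  assumes "module_hom (*s) (*s) \<phi>"
  shows "ext_map1 \<phi> \<in> ext_odd \<rightarrow> ext_odd"
proof (rule funcsetI)
  fix \<omega> :: "('r, 'n) ext"
  assume \<omega>: "\<omega> \<in> ext_odd"
  have "ext_map \<phi> \<omega> \<in> ext.span {wedge ys | ys. odd (length ys)}"
  proof (rule ext_span_image[where f = "ext_map \<phi>" and A = "{wedge ys | ys. odd (length ys)}"])
    show "ext_map \<phi> t \<in> ext.span {wedge ys | ys. odd (length ys)}"
      if "t \<in> {wedge ys | ys. odd (length ys)}" for t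
      using that by (auto simp: ext_map_wedge[OF assms] intro!: ext.span_base)
  qed (use \<omega> in \<open>simp_all add: ext_odd_eq_span ext_map_add[OF assms] ext_map_scale[OF assms]\<close>)
  then show "ext_map1 \<phi> \<omega> \<in> ext_odd"
    using \<omega> by (simp add: ext_map1_def ext_odd_eq_span)
qed

lemma Phi_wedge_odd:
  assumes "module_hom (*s) (*) \<xi>" "odd (length ys)"
  shows "Phi x' \<xi> (wedge ys) \<in> ext_even"
proof -
  have "ext_vec x' * wedge ys = wedge (x' # ys)"
    by (simp add: wedge_def)
  moreover have "ext_contract \<xi> (wedge ys) \<in> ext_even"
    unfolding ext_contract_wedge[OF assms(1)] ext_even_eq_span
    by (intro ext.span_sum ext.span_scale ext.span_base) (use assms(2) in auto)
  ultimately show ?thesis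
    using wedge_in_even[of "x' # ys"] assms(2)
    by (simp add: Phi_def ext_even_eq_span ext.span_add)
qed

lemma Phi10_in:
  fixes \<xi> :: "'r::comm_ring_1 ^ 'n::finite \<Rightarrow> 'r"
  assumes "module_hom (*s) (*) \<xi>"
  shows "Phi10 x' \<xi> \<in> ext_odd \<rightarrow> ext_even"
proof (rule funcsetI)
  fix \<omega> :: "('r, 'n) ext"
  assume \<omega>: "\<omega> \<in> ext_odd"
  have "Phi x' \<xi> \<omega> \<in> ext.span {wedge ys | ys. even (length ys)}"
  proof (rule ext_span_image[where f = "Phi x' \<xi>" and A = "{wedge ys | ys. odd (length ys)}"])
    show "Phi x' \<xi> t \<in> ext.span {wedge ys | ys. even (length ys)}"
      if "t \<in> {wedge ys | ys. odd (length ys)}" for t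
      using that Phi_wedge_odd[OF assms] by (auto simp: ext_even_eq_span)
  qed (use \<omega> in \<open>simp_all add: ext_odd_eq_span Phi_def ext_contract_add[OF assms]
      ext_contract_scale[OF assms] distrib_left add_ac ext_scale_mult_right ext.scale_right_distrib\<close>)
  then show "Phi10 x' \<xi> \<omega> \<in> ext_even"
    using \<omega> by (simp add: Phi10_def ext_even_eq_span)
qed

lemma module_vec: "module ((*s) :: 'r::comm_ring_1 \<Rightarrow> 'r ^ 'n \<Rightarrow> 'r ^ 'n)"
  by unfold_locales (simp_all add: vec_eq_iff distrib_left distrib_right mult.assoc)

lemma module_ring: "module ((*) :: 'r::comm_ring_1 \<Rightarrow> 'r \<Rightarrow> 'r)"
  by unfold_locales (simp_all add: distrib_left distrib_right mult.assoc)

lemma module_hom_matrix_vector_mult: "module_hom (*s) (*s) ((*v) (A :: 'r::comm_ring_1 ^ 'n ^ 'm))"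
  by (intro module_hom.intro module_vec module_hom_axioms.intro matrix_vector_right_distrib)
    (simp add: vec_eq_iff matrix_vector_mult_def sum_distrib_left mult.left_commute)

lemma module_hom_scalar_product:
  "module_hom (*s) (*) (scalar_product (f :: 'r::comm_ring_1 ^ 'n))"
  by (intro module_hom.intro module_vec module_ring module_hom_axioms.intro)
    (simp_all add: scalar_product_def distrib_left sum.distrib sum_distrib_left mult.left_commute)

end

theory Submission
  imports Defs
begin

text \<open>Conjugation by the induced algebra map treats the two summands of \<open>Phi\<close>
  separately. Being multiplicative and inverse to \<open>ext_map \<phi>\<close>, the map
  \<open>ext_map \<psi>\<close> turns left multiplication by \<open>x'\<close> into left
  multiplication by \<open>\<psi> x'\<close>. Contracting a wedge of vectors \<phi> y_i against
  \<xi> produces coefficients \<xi>(\<phi> y_i), and \<psi> restores the surviving factors, so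
  contraction against \<open>\<xi> \<circ> \<phi>\<close> results. This is
  \<open>Phi_conjugate\<close>; determinant one supplies the inverse matrix by Cramer's rule, and
  parity lets the restricted maps be composed.\<close>

lemma det_one_right_inverse:
  fixes A :: "'r::comm_ring_1 ^ 'n::finite ^ 'n"
  assumes "det A = 1"
  shows "\<exists>B. A ** B = mat 1"
proof
  \<comment> \<open>The adjugate, as the library inverts matrices by determinants only over fields.\<close>
  define B :: "'r ^ 'n ^ 'n"
    where "B = (\<chi> k j. det (\<chi> l. if l = j then axis k 1 else A $ l))"
  have "(\<Sum>k\<in>UNIV. A $ i $ k * B $ k $ j) = mat 1 $ i $ j" for i j
  proof -
    have "(\<Sum>k\<in>UNIV. A $ i $ k * B $ k $ j)
        = (\<Sum>k\<in>UNIV. det (\<chi> l. if l = j then A $ i $ k *s axis k 1 else A $ l))"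
      unfolding B_def by (simp add: det_row_mul)
    \<comment> \<open>Multilinearity in row j reassembles row i of \<open>A\<close> there: the
      determinant becomes \<open>det A\<close> if i = j, and otherwise has two equal rows.\<close>
    also have "\<dots> = det (\<chi> l. if l = j then \<Sum>k\<in>UNIV. A $ i $ k *s axis k 1 else A $ l)"
      by (rule det_linear_row_sum[symmetric]) simp
    also have "(\<Sum>k\<in>UNIV. A $ i $ k *s axis k 1) = A $ i"
      by (simp add: basis_expansion)
    also have "det (\<chi> l. if l = j then A $ i else A $ l) = mat 1 $ i $ j"
    proof (cases "i = j")
      case True
      then have "(\<chi> l. if l = j then A $ i else A $ l) = A"
        by (simp add: vec_eq_iff)
      then show ?thesis
        using True assms by (simp add: mat_def)
    next
      case False
      then have "det (\<chi> l. if l = j then A $ i else A $ l) = 0"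
        by (intro det_identical_rows[of i j]) (simp_all add: row_def)
      then show ?thesis
        using False by (simp add: mat_def)
    qed
    finally show ?thesis .
  qed
  then show "A ** B = mat 1"
    by (simp add: vec_eq_iff matrix_matrix_mult_def)
qed

text \<open>A right inverse of the transpose gives a left inverse of \<open>A\<close>, which
  associativity identifies with the right inverse.\<close>

lemma det_one_imp_invertible:
  fixes A :: "'r::comm_ring_1 ^ 'n::finite ^ 'n"
  assumes "det A = 1"
  shows "invertible A"
proof -
  obtain B where B: "A ** B = mat 1"
    using det_one_right_inverse[OF assms] by blast
  obtain C where "transpose A ** C = mat 1"
    using det_one_right_inverse[of "transpose A"] assms by (auto simp: det_transpose)
  then have C: "transpose C ** A = mat 1"
    by (metis matrix_transpose_mul transpose_mat transpose_transpose)
  then have "transpose C = B"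
    by (metis B matrix_mul_assoc matrix_mul_lid matrix_mul_rid)
  then show ?thesis
    using B C by (auto simp: invertible_def)
qed

lemma matrix_inv_left_det_one:
  fixes A :: "'r::comm_ring_1 ^ 'n::finite ^ 'n"
  assumes "det A = 1"
  shows "matrix_inv A ** A = mat 1"
  \<comment> \<open>\<open>matrix_inv\<close> is a Hilbert choice, so it has its defining property
    once some inverse exists.\<close>
  using someI_ex[OF det_one_imp_invertible[OF assms, unfolded invertible_def]]
  unfolding matrix_inv_def by blast

context
  fixes \<phi> \<psi> :: "'r::comm_ring_1 ^ 'n::finite \<Rightarrow> 'r ^ 'n"
  assumes \<phi>: "module_hom (*s) (*s) \<phi>" and \<psi>: "module_hom (*s) (*s) \<psi>"
    and left_inverse: "\<And>v. \<psi> (\<phi> v) = v"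
begin

lemma ext_map_left_inverse: "ext_map \<psi> (ext_map \<phi> \<omega>) = \<omega>"
proof (induction \<omega> rule: ext_induct)
  case zero
  show ?case
    \<comment> \<open>Homogeneity with scalar 0 shows that both maps send 0 to 0.\<close>
    using ext_map_scale[OF \<phi>, of 0 0] ext_map_scale[OF \<psi>, of 0 0] by simp
next
  case (wedge ys)
  show ?case
    by (simp add: ext_map_wedge[OF \<phi>] ext_map_wedge[OF \<psi>] left_inverse o_def)
qed (simp_all add: ext_map_add[OF \<phi>] ext_map_add[OF \<psi>] ext_map_scale[OF \<phi>] ext_map_scale[OF \<psi>])

text \<open>By linearity it suffices to compare wedges termwise: deleting the i-th factor commutes
  with mapping the list, and \<psi> cancels \<phi> on the factors that remain.\<close>

lemma ext_map_contract_conjugate: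
  assumes \<xi>: "module_hom (*s) (*) \<xi>"
  shows "ext_map \<psi> (ext_contract \<xi> (ext_map \<phi> \<omega>)) = ext_contract (\<xi> \<circ> \<phi>) \<omega>"
proof -
  have \<xi>\<phi>: "module_hom (*s) (*) (\<lambda>v. \<xi> (\<phi> v))"
    using module_hom_compose[OF \<phi> \<xi>] by (simp add: o_def)
  have map_zero: "ext_map \<psi> 0 = 0"
    using ext_map_scale[OF \<psi>, of 0 0] by simp
  have map_sum: "ext_map \<psi> (sum f A) = (\<Sum>i\<in>A. ext_map \<psi> (f i))" for f :: "nat \<Rightarrow> _" and A
    by (induction A rule: infinite_finite_induct) (simp_all add: map_zero ext_map_add[OF \<psi>])
  show ?thesis
    unfolding o_def
  proof (induction \<omega> rule: ext_induct)
    case zero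
    show ?case
      using ext_map_scale[OF \<phi>, of 0 0] ext_contract_scale[OF \<xi>, of 0 0]
        ext_contract_scale[OF \<xi>\<phi>, of 0 0] map_zero by simp
  next
    case (wedge ys)
    show ?case
      by (simp add: ext_map_wedge[OF \<phi>] ext_contract_wedge[OF \<xi>] ext_contract_wedge[OF \<xi>\<phi>]
          map_sum ext_map_scale[OF \<psi>] ext_map_wedge[OF \<psi>] take_map drop_map left_inverse o_def)
  qed (simp_all add: ext_map_add[OF \<phi>] ext_map_add[OF \<psi>] ext_map_scale[OF \<phi>] ext_map_scale[OF \<psi>]
      ext_contract_add[OF \<xi>] ext_contract_scale[OF \<xi>]
      ext_contract_add[OF \<xi>\<phi>] ext_contract_scale[OF \<xi>\<phi>])
qed

lemma Phi_conjugate: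
  assumes \<xi>: "module_hom (*s) (*) \<xi>"
  shows "ext_map \<psi> (Phi x' \<xi> (ext_map \<phi> \<omega>)) = Phi (\<psi> x') (\<xi> \<circ> \<phi>) \<omega>"
proof -
  have "ext_map \<psi> (ext_vec x') = ext_vec (\<psi> x')"
    using ext_map_wedge[OF \<psi>, of "[x']"] by (simp add: wedge_def)
  then show ?thesis
    by (simp add: Phi_def ext_map_add[OF \<psi>] ext_map_mult[OF \<psi>] ext_map_left_inverse
        ext_map_contract_conjugate[OF \<xi>])
qed

end

theorem theorem3p6:
  fixes pa fb :: "'r::comm_ring_1 ^ 'n::finite"
    and \<phi> :: "'r ^ 'n ^ 'n"
  assumes "det \<phi> = 1"
  shows "Phi10 (matrix_inv \<phi> *v pa) (scalar_product fb \<circ> (*v) \<phi>)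
    = compose ext_odd (ext_map0 ((*v) (matrix_inv \<phi>)))
        (compose ext_odd (Phi10 pa (scalar_product fb)) (ext_map1 ((*v) \<phi>)))"
proof
  fix \<omega> :: "('r, 'n) ext"
  let ?inv = "(*v) (matrix_inv \<phi>)" and ?\<phi> = "(*v) \<phi>" and ?\<xi> = "scalar_product fb"
  show "Phi10 (matrix_inv \<phi> *v pa) (?\<xi> \<circ> ?\<phi>) \<omega>
    = compose ext_odd (ext_map0 ?inv) (compose ext_odd (Phi10 pa ?\<xi>) (ext_map1 ?\<phi>)) \<omega>"
  proof (cases "\<omega> \<in> ext_odd")
    case True
    \<comment> \<open>The two parity facts place each intermediate value inside the domain of the
      next restricted map, so all restrictions can be unfolded.\<close>
    have odd: "ext_map ?\<phi> \<omega> \<in> ext_odd"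
      using ext_map1_in[OF module_hom_matrix_vector_mult] True
      by (metis PiE ext_map1_def restrict_apply')
    then have even: "Phi pa ?\<xi> (ext_map ?\<phi> \<omega>) \<in> ext_even"
      using Phi10_in[OF module_hom_scalar_product]
      by (metis PiE Phi10_def restrict_apply')
    have "matrix_inv \<phi> *v (\<phi> *v v) = v" for v
      by (simp add: matrix_vector_mul_assoc matrix_inv_left_det_one[OF assms])
    then have "ext_map ?inv (Phi pa ?\<xi> (ext_map ?\<phi> \<omega>)) = Phi (?inv pa) (?\<xi> \<circ> ?\<phi>) \<omega>"
      by (intro Phi_conjugate module_hom_matrix_vector_mult module_hom_scalar_product)
    with True odd even show ?thesis
      by (simp add: compose_def Phi10_def ext_map0_def ext_map1_def)
  \<comment> \<open>Outside \<open>ext_odd\<close> both sides are \<open>undefined\<close>.\<close>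
  qed (simp add: compose_def Phi10_def)
qed

end
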